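(* For any signed sets $X,Y$ and $A,B\subset X$, if $\phi:Y\Rrightarrow X\setminus A$ and $\psi:X\setminus B\Rrightarrow Y$ are cobordisms, then $$(\operatorname{id}(A)+\operatorname{create}(\phi))\triangleleft(\operatorname{id}(B)-\operatorname{create}(\psi))$$ is a (well-defined) cobordism $A\Rrightarrow B$.
   Context: A matching is a bijection between finite sets, written $P\Rrightarrow Q$. $X+Y$ denotes disjoint union of sets, treated as strictly commutative and associative by the usual identifications. Cancellation: if $F:P+E\Rrightarrow Q+E$ is a matching of finite sets (the two copies of $E$ being identified), then $\operatorname{cancel}(E,F):P\Rrightarrow Q$ is the matching sending $p$ to the first element outside the summand $E$ among $F(p),F(F(p)),\dots$. A signed set is an ordered pair $A=\langle A^+,A^-\rangle$ of finite sets; $|A|=A^+ + A^-$; $0=\langle\emptyset,\emptyset\rangle$. Operations: $A+B=\langle A^+ + B^+,A^- + B^-\rangle$, $-A=\langle A^-,A^+\rangle$, $A-B=A+(-B)$; sums are commutative and associative with unit $0$ up to the usual identifications. $A\subset X$ means $A^+\subset X^+$ and $A^-\subset X^-$, and then $X\setminus A=\langle X^+\setminus A^+,X^-\setminus A^-\rangle$; the signed set $A+(X\setminus A)$ is identified with $X$ in the obvious way. A cobordism $f:A\Rrightarrow B$ of signed sets is a triple $(|f|,A,B)$ where $|f|:A^+ + B^-\Rrightarrow A^- + B^+$ is a matching. Composition (natural order): for $f:A\Rrightarrow B$, $g:B\Rrightarrow C$, the cobordism $f\triangleleft g:A\Rrightarrow C$ has $|f\triangleleft g|=\operatorname{cancel}(|B|,|f|+|g|)$,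 where $|f|+|g|: A^+ + |B| + C^-\Rrightarrow A^- + |B| + C^+$ is the disjoint union. Arithmetic of cobordisms: for $f:A\Rrightarrow B$ and $g:C\Rrightarrow D$, $f+g:A+C\Rrightarrow B+D$ has $|f+g|=|f|+|g|$ (disjoint union of matchings); $-f:-B\Rrightarrow -A$ has $|-f|=|f|$; $f-g=f+(-g)$. The identity $\operatorname{id}(A):A\Rrightarrow A$ has $|\operatorname{id}(A)|=\operatorname{id}(|A|)$. For a cobordism $\phi:A\Rrightarrow B$, the creation cobordism $\operatorname{create}(\phi):0\Rrightarrow B-A$ has $|\operatorname{create}(\phi)|=|\phi|:A^+ + B^-\Rrightarrow A^- + B^+$ (noting $(B-A)^-=A^+ + B^-$ and $(B-A)^+=A^- + B^+$); its negative is $-\operatorname{create}(\phi):A-B\Rrightarrow 0$. *)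

theory Defs
  imports Main
begin

text \<open>
  Disjoint unions are sum types. The strict associativity, commutativity and unit laws of the
  disjoint union are realised by the explicit canonical maps below, and two signed sets that
  are usually identified are connected by \<open>relabel\<close>.
\<close>

fun sum_swap :: "'a + 'b \<Rightarrow> 'b + 'a" where
  "sum_swap (Inl a) = Inr a"
| "sum_swap (Inr b) = Inl b"

fun sum_assoc :: "'a + ('b + 'c) \<Rightarrow> ('a + 'b) + 'c" where
  "sum_assoc (Inl a) = Inl (Inl a)"
| "sum_assoc (Inr (Inl b)) = Inl (Inr b)"
| "sum_assoc (Inr (Inr c)) = Inr c"

fun sum_interchange :: "('a + 'b) + ('c + 'd) \<Rightarrow> ('a + 'c) + ('b + 'd)" where
  "sum_interchange (Inl (Inl a)) = Inl (Inl a)"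
| "sum_interchange (Inl (Inr b)) = Inr (Inl b)"
| "sum_interchange (Inr (Inl c)) = Inl (Inr c)"
| "sum_interchange (Inr (Inr d)) = Inr (Inr d)"

fun sum_merge :: "'a + 'a \<Rightarrow> 'a" where
  "sum_merge (Inl a) = a"
| "sum_merge (Inr a) = a"


definition matching :: "('p \<Rightarrow> 'q) \<Rightarrow> 'p set \<Rightarrow> 'q set \<Rightarrow> bool" where
  "matching F P Q \<longleftrightarrow> finite P \<and> finite Q \<and> bij_betw F P Q"

text \<open>
  For \<open>F\<close> from \<open>P <+> E\<close> to \<open>Q <+> E\<close>, the sequence \<open>F p, F (F p), \<dots>\<close>; it is
  continued by a constant once an element of \<open>Q\<close> has been reached, where \<open>F\<close> cannot
  be applied any more.
\<close>

primrec iterates :: "('p + 'e \<Rightarrow> 'q + 'e) \<Rightarrow> 'p \<Rightarrow> nat \<Rightarrow> 'q + 'e" where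
  "iterates F p 0 = F (Inl p)"
| "iterates F p (Suc n) = (case iterates F p n of Inl q \<Rightarrow> Inl q | Inr e \<Rightarrow> F (Inr e))"

definition cancel :: "'e set \<Rightarrow> ('p + 'e \<Rightarrow> 'q + 'e) \<Rightarrow> 'p \<Rightarrow> 'q" where
  "cancel E F p = projl (iterates F p (LEAST n. iterates F p n \<notin> Inr ` E))"

definition cancel_defined :: "'p set \<Rightarrow> 'e set \<Rightarrow> ('p + 'e \<Rightarrow> 'q + 'e) \<Rightarrow> bool" where
  "cancel_defined P E F \<longleftrightarrow> (\<forall>p\<in>P. \<exists>n. iterates F p n \<notin> Inr ` E)"


datatype 'a signed = Signed (pos: "'a set") (neg: "'a set")

definition signed_set :: "'a signed \<Rightarrow> bool" where
  "signed_set A \<longleftrightarrow> finite (pos A) \<and> finite (neg A)"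

definition support :: "'a signed \<Rightarrow> ('a + 'a) set" where
  "support A = pos A <+> neg A"

text \<open>There is no empty type to carry the signed set 0; the type \<^typ>\<open>unit\<close> is used.\<close>

definition zero_signed :: "unit signed" where
  "zero_signed = Signed {} {}"

definition add_signed :: "'a signed \<Rightarrow> 'b signed \<Rightarrow> ('a + 'b) signed" (infixl "\<oplus>" 65) where
  "A \<oplus> B = Signed (pos A <+> pos B) (neg A <+> neg B)"

definition neg_signed :: "'a signed \<Rightarrow> 'a signed" where
  "neg_signed A = Signed (neg A) (pos A)"

definition diff_signed :: "'a signed \<Rightarrow> 'b signed \<Rightarrow> ('a + 'b) signed" (infixl "\<ominus>" 65) where
  "A \<ominus> B = A \<oplus> neg_signed B"

definition sub_signed :: "'a signed \<Rightarrow> 'a signed \<Rightarrow> bool" (infix "\<sqsubseteq>" 50) where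
  "A \<sqsubseteq> X \<longleftrightarrow> pos A \<subseteq> pos X \<and> neg A \<subseteq> neg X"

definition setminus_signed :: "'a signed \<Rightarrow> 'a signed \<Rightarrow> 'a signed" (infixl "\<setminus>" 65) where
  "X \<setminus> A = Signed (pos X - pos A) (neg X - neg A)"

definition image_signed :: "('a \<Rightarrow> 'b) \<Rightarrow> 'a signed \<Rightarrow> 'b signed" where
  "image_signed i A = Signed (i ` pos A) (i ` neg A)"


datatype ('a, 'b) cobordism =
  Cobordism (mat: "'a + 'b \<Rightarrow> 'a + 'b") (source: "'a signed") (target: "'b signed")

definition is_cobordism :: "('a, 'b) cobordism \<Rightarrow> 'a signed \<Rightarrow> 'b signed \<Rightarrow> bool"
  ("(_ :/ _ \<Rrightarrow> _)" [51, 51, 51] 50) where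
  "f : A \<Rrightarrow> B \<longleftrightarrow> source f = A \<and> target f = B \<and> signed_set A \<and> signed_set B \<and>
     matching (mat f) (pos A <+> neg B) (neg A <+> pos B)"

text \<open>
  \<open>relabel i j f\<close> is \<open>f\<close> transported along the identifications \<open>i\<close> of its source and \<open>j\<close> of
  its target. These need to be injective only on the positive and on the negative part
  separately, so the inverse is taken on the domain of the matching.
\<close>

definition relabel ::
    "('a \<Rightarrow> 'c) \<Rightarrow> ('b \<Rightarrow> 'd) \<Rightarrow> ('a, 'b) cobordism \<Rightarrow> ('c, 'd) cobordism" where
  "relabel i j f = Cobordism
     (map_sum i j \<circ> mat f \<circ> inv_into (pos (source f) <+> neg (target f)) (map_sum i j))
     (image_signed i (source f)) (image_signed j (target f))"

text \<open>
  The following two maps sort the summands of \<open>|f| + |g|\<close> for \<open>f : A \<Rrightarrow> B\<close> and \<open>g : B \<Rrightarrow> C\<close>;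
  the summand \<open>|B|\<close> to be cancelled is \<open>pos B <+> neg B\<close>. The first goes from
  \<open>(pos A + neg C) + (pos B + neg B)\<close> to \<open>(pos A + neg B) + (pos B + neg C)\<close>, the second from
  \<open>(neg A + pos B) + (neg B + pos C)\<close> to \<open>(neg A + pos C) + (pos B + neg B)\<close>.
\<close>

fun split_middle :: "('a + 'c) + ('b + 'b) \<Rightarrow> ('a + 'b) + ('b + 'c)" where
  "split_middle (Inl (Inl a)) = Inl (Inl a)"
| "split_middle (Inl (Inr c)) = Inr (Inr c)"
| "split_middle (Inr (Inl b)) = Inr (Inl b)"
| "split_middle (Inr (Inr b)) = Inl (Inr b)"

fun join_middle :: "('a + 'b) + ('b + 'c) \<Rightarrow> ('a + 'c) + ('b + 'b)" where
  "join_middle (Inl (Inl a)) = Inl (Inl a)"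
| "join_middle (Inl (Inr b)) = Inr (Inl b)"
| "join_middle (Inr (Inl b)) = Inr (Inr b)"
| "join_middle (Inr (Inr c)) = Inl (Inr c)"

definition union_mat ::
    "('a, 'b) cobordism \<Rightarrow> ('b, 'c) cobordism \<Rightarrow> ('a + 'c) + ('b + 'b) \<Rightarrow> ('a + 'c) + ('b + 'b)" where
  "union_mat f g = join_middle \<circ> map_sum (mat f) (mat g) \<circ> split_middle"

definition comp_cob ::
    "('a, 'b) cobordism \<Rightarrow> ('b, 'c) cobordism \<Rightarrow> ('a, 'c) cobordism" (infixl "\<triangleleft>" 60) where
  "f \<triangleleft> g = Cobordism (cancel (support (target f)) (union_mat f g)) (source f) (target g)"

definition comp_defined :: "('a, 'b) cobordism \<Rightarrow> ('b, 'c) cobordism \<Rightarrow> bool" where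
  "comp_defined f g \<longleftrightarrow> target f = source g \<and>
     cancel_defined (pos (source f) <+> neg (target g)) (support (target f)) (union_mat f g)"

definition add_cob ::
    "('a, 'b) cobordism \<Rightarrow> ('c, 'd) cobordism \<Rightarrow> ('a + 'c, 'b + 'd) cobordism" where
  "add_cob f g = Cobordism
     (sum_interchange \<circ> map_sum (mat f) (mat g) \<circ> sum_interchange)
     (source f \<oplus> source g) (target f \<oplus> target g)"

definition neg_cob :: "('a, 'b) cobordism \<Rightarrow> ('b, 'a) cobordism" where
  "neg_cob f = Cobordism (sum_swap \<circ> mat f \<circ> sum_swap)
     (neg_signed (target f)) (neg_signed (source f))"

definition diff_cob ::
    "('a, 'b) cobordism \<Rightarrow> ('c, 'd) cobordism \<Rightarrow> ('a + 'd, 'b + 'c) cobordism" where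
  "diff_cob f g = add_cob f (neg_cob g)"

text \<open>
  The identity of \<open>|A|\<close> goes from \<open>pos A <+> neg A\<close> to \<open>neg A <+> pos A\<close>, so it appears as
  the exchange of the two summands.
\<close>

definition id_cob :: "'a signed \<Rightarrow> ('a, 'a) cobordism" where
  "id_cob A = Cobordism sum_swap A A"

definition create :: "('a, 'b) cobordism \<Rightarrow> (unit, 'b + 'a) cobordism" where
  "create \<phi> = Cobordism (map_sum id (sum_swap \<circ> mat \<phi> \<circ> sum_swap))
     zero_signed (target \<phi> \<ominus> source \<phi>)"


text \<open>The identification of \<open>A \<oplus> 0\<close> with \<open>A\<close>.\<close>

definition ident_zero :: "'a + unit \<Rightarrow> 'a" where
  "ident_zero = projl"

text \<open>The identification of \<open>A \<oplus> ((X \<setminus> A) \<ominus> Y)\<close> with \<open>X \<ominus> Y\<close>.\<close>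

definition ident_compl :: "'x + ('x + 'y) \<Rightarrow> 'x + 'y" where
  "ident_compl = map_sum sum_merge id \<circ> sum_assoc"

text \<open>The identification of \<open>B \<oplus> neg_signed (Y \<ominus> (X \<setminus> B))\<close> with \<open>X \<ominus> Y\<close>.\<close>

definition ident_neg_compl :: "'x + ('y + 'x) \<Rightarrow> 'x + 'y" where
  "ident_neg_compl = ident_compl \<circ> map_sum id sum_swap"

end

theory Submission
  imports Defs
begin

text \<open>
  Both factors are cobordisms because sums, negatives, creations and transports along
  identifications of cobordisms are cobordisms. Their composite exists and is a cobordism because
  cancellation of a finite set \<open>E\<close> from a matching \<open>F : P + E \<Rrightarrow> Q + E\<close> is well defined: by
  injectivity of \<open>F\<close>, trajectories can be traced back uniquely, so they neither cycle inside \<open>E\<close>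
  nor merge.
\<close>

section \<open>Cancellation of a finite summand\<close>

text \<open>Equal end points have equal predecessors, as \<open>F\<close> is injective on
  \<open>P <+> E\<close> and both trajectories stayed in \<open>E\<close> before. Tracing back step
  by step, both must reach their \<open>Inl\<close> starting points at the same time.\<close>

lemma iterates_eqD:
  assumes inj: "inj_on F (P <+> E)"
    and "p \<in> P" "p' \<in> P"
    and "\<forall>k<m. iterates F p k \<in> Inr ` E" "\<forall>k<n. iterates F p' k \<in> Inr ` E"
    and "iterates F p m = iterates F p' n"
  shows "p = p' \<and> m = n"
  using assms(4-)
proof (induction m arbitrary: n)
  case 0
  show ?case
  proof (cases n)
    case 0
    then show ?thesis
      using "0.prems" inj_onD[OF inj, of "Inl p" "Inl p'"] assms(2,3) by auto
  next
    case (Suc l)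
    \<comment> \<open>This case is contradictory: \<open>F\<close> would agree on
      \<open>Inl p\<close> and \<open>Inr e\<close>.\<close>
    then obtain e where "e \<in> E" "iterates F p' l = Inr e"
      using "0.prems" by blast
    then show ?thesis
      using Suc "0.prems" inj_onD[OF inj, of "Inl p" "Inr e"] assms(2) by auto
  qed
next
  case (Suc m)
  obtain e where e: "e \<in> E" "iterates F p m = Inr e"
    using Suc.prems by blast
  show ?case
  proof (cases n)
    case 0
    then show ?thesis
      using e Suc.prems inj_onD[OF inj, of "Inr e" "Inl p'"] assms(3) by auto
  next
    case (Suc l)
    then obtain e' where e': "e' \<in> E" "iterates F p' l = Inr e'"
      using Suc.prems by blast
    then have "e = e'"
      using e Suc Suc.prems inj_onD[OF inj, of "Inr e" "Inr e'"] by auto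
    then show ?thesis
      using Suc Suc.IH[of l] Suc.prems e e' by simp
  qed
qed

lemma cancel_defined_if_inj_on:
  assumes "inj_on F (P <+> E)" and "finite E"
  shows "cancel_defined P E F"
  unfolding cancel_defined_def
proof (rule ballI, rule ccontr)
  fix p
  assume p: "p \<in> P" and "\<nexists>n. iterates F p n \<notin> Inr ` E"
  then have all: "iterates F p n \<in> Inr ` E" for n
    by blast
  then have "inj (iterates F p)"
    using iterates_eqD[OF assms(1) p p] by (auto intro: injI)
  moreover have "finite (range (iterates F p))"
    using all \<open>finite E\<close> by (meson finite_imageI finite_subset image_subsetI)
  ultimately show False
    using finite_imageD infinite_UNIV_nat by blast
qed

text \<open>Trajectories with the same exit point start at the same point, which gives injectivity;
  surjectivity follows by counting.\<close>

lemma matching_cancel: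
  assumes F: "matching F (P <+> E) (Q <+> E)"
  shows "cancel_defined P E F" and "matching (cancel E F) P Q"
proof -
  have fin: "finite P" "finite Q" "finite E"
    and inj: "inj_on F (P <+> E)" and maps: "F ` (P <+> E) = Q <+> E"
    using F by (auto simp: matching_def bij_betw_def dest: finite_PlusD)
  show def: "cancel_defined P E F"
    using inj fin(3) by (rule cancel_defined_if_inj_on)
  \<comment> \<open>The exit time that occurs in the definition of \<open>cancel\<close>.\<close>
  define N where "N p = (LEAST n. iterates F p n \<notin> Inr ` E)" for p
  have before: "\<forall>k<N p. iterates F p k \<in> Inr ` E" for p
    unfolding N_def using not_less_Least by blast
  have F_in: "F x \<in> Q <+> E" if "x \<in> P <+> E" for x
    using imageI[OF that, of F] maps by simp
  have range: "iterates F p n \<in> Q <+> E" if "p \<in> P" for p n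
  proof (induction n)
    case 0
    show ?case using F_in[OF InlI[OF that]] by simp
  next
    case (Suc n)
    then show ?case
      using F_in[OF InrI] by (cases "iterates F p n") auto
  qed
  have stop: "iterates F p (N p) = Inl (cancel E F p) \<and> cancel E F p \<in> Q" if "p \<in> P" for p
  proof -
    have "iterates F p (N p) \<notin> Inr ` E"
      unfolding N_def using def that LeastI_ex[of "\<lambda>n. iterates F p n \<notin> Inr ` E"]
      by (auto simp: cancel_defined_def)
    then show ?thesis
      using range[OF that, of "N p"] by (auto simp: cancel_def N_def)
  qed
  have inj_cancel: "inj_on (cancel E F) P"
  proof (rule inj_onI)
    fix p p'
    assume "p \<in> P" "p' \<in> P" "cancel E F p = cancel E F p'"
    then show "p = p'"
      using iterates_eqD[OF inj _ _ before before, of p p'] stop by simp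
  qed
  have "card (P <+> E) = card (Q <+> E)"
    using F by (auto simp: matching_def dest: bij_betw_same_card)
  then have "card P = card Q"
    using fin by (simp add: card_Plus)
  moreover have "cancel E F ` P \<subseteq> Q"
    using stop by blast
  ultimately have "cancel E F ` P = Q"
    using fin inj_cancel by (simp add: card_image card_subset_eq)
  then show "matching (cancel E F) P Q"
    using fin inj_cancel by (simp add: matching_def bij_betw_def)
qed

section \<open>Matchings of disjoint unions\<close>

lemma matching_comp:
  "matching F P Q \<Longrightarrow> matching G Q R \<Longrightarrow> matching (G \<circ> F) P R"
  by (auto simp: matching_def intro: bij_betw_trans)

lemma matching_map_sum:
  assumes "matching F P Q" and "matching G R S"
  shows "matching (map_sum F G) (P <+> R) (Q <+> S)"
proof -
  have "inj_on (map_sum F G) (P <+> R)"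
    using assms by (auto simp: matching_def bij_betw_def intro!: inj_onI dest: inj_onD)
  moreover have "map_sum F G ` (P <+> R) = F ` P <+> G ` R"
    by (simp add: Plus_def image_Un image_image)
  ultimately show ?thesis
    using assms by (auto simp: matching_def bij_betw_def)
qed

lemma matching_sum_swap:
  assumes "finite P" and "finite Q"
  shows "matching sum_swap (P <+> Q) (Q <+> P)"
  unfolding matching_def
  using assms by (auto intro!: bij_betw_byWitness[where f' = sum_swap])

lemma matching_sum_interchange:
  assumes "finite P" and "finite Q" and "finite R" and "finite S"
  shows "matching sum_interchange ((P <+> Q) <+> (R <+> S)) ((P <+> R) <+> (Q <+> S))"
  unfolding matching_def
  using assms by (auto intro!: bij_betw_byWitness[where f' = sum_interchange])

lemma matching_split_middle:
  assumes "finite P" and "finite Q" and "finite R" and "finite S"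
  shows "matching split_middle ((P <+> Q) <+> (R <+> S)) ((P <+> S) <+> (R <+> Q))"
  unfolding matching_def
  \<comment> \<open>\<open>split_middle\<close> followed by \<open>join_middle\<close> exchanges the
    two middle summands, so the inverse needs one more \<open>sum_swap\<close>.\<close>
  using assms by (auto intro!: bij_betw_byWitness[where f' = "map_sum id sum_swap \<circ> join_middle"])

lemma matching_join_middle:
  assumes "finite P" and "finite Q" and "finite R" and "finite S"
  shows "matching join_middle ((P <+> Q) <+> (R <+> S)) ((P <+> S) <+> (Q <+> R))"
  unfolding matching_def
  using assms by (auto intro!: bij_betw_byWitness[where f' = "split_middle \<circ> map_sum id sum_swap"])

section \<open>Composition and arithmetic of cobordisms\<close>

lemma is_cobordism_comp:
  assumes f: "f : A \<Rrightarrow> B" and g: "g : B \<Rrightarrow> C"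
  shows "comp_defined f g" and "f \<triangleleft> g : A \<Rrightarrow> C"
proof -
  have "matching (map_sum (mat f) (mat g))
      ((pos A <+> neg B) <+> (pos B <+> neg C)) ((neg A <+> pos B) <+> (neg B <+> pos C))"
    using f g by (simp add: is_cobordism_def matching_map_sum)
  \<comment> \<open>The domains of \<open>f\<close> and \<open>g\<close> contribute
    \<open>neg B\<close> and \<open>pos B\<close>, their codomains \<open>pos B\<close> and
    \<open>neg B\<close>. After sorting, both sides contain the same summand
    \<open>support B\<close>, as cancellation requires.\<close>
  then have "matching (union_mat f g)
      ((pos A <+> neg C) <+> support B) ((neg A <+> pos C) <+> support B)"
    unfolding union_mat_def support_def using f g
    by (intro matching_comp[OF matching_split_middle] matching_comp[OF _ matching_join_middle])
      (auto simp: is_cobordism_def signed_set_def)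
  note matching_cancel[OF this]
  then show "comp_defined f g" and "f \<triangleleft> g : A \<Rrightarrow> C"
    using f g by (auto simp: comp_defined_def comp_cob_def is_cobordism_def)
qed

lemma is_cobordism_id: "signed_set A \<Longrightarrow> id_cob A : A \<Rrightarrow> A"
  by (simp add: is_cobordism_def id_cob_def signed_set_def matching_sum_swap)

lemma is_cobordism_add:
  assumes "f : A \<Rrightarrow> B" and "g : C \<Rrightarrow> D"
  shows "add_cob f g : A \<oplus> C \<Rrightarrow> B \<oplus> D"
proof -
  have "matching (map_sum (mat f) (mat g))
      ((pos A <+> neg B) <+> (pos C <+> neg D)) ((neg A <+> pos B) <+> (neg C <+> pos D))"
    using assms by (simp add: is_cobordism_def matching_map_sum)
  then have "matching (sum_interchange \<circ> map_sum (mat f) (mat g) \<circ> sum_interchange)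
      ((pos A <+> pos C) <+> (neg B <+> neg D)) ((neg A <+> neg C) <+> (pos B <+> pos D))"
    using assms
    by (intro matching_comp[OF matching_sum_interchange]
        matching_comp[OF _ matching_sum_interchange])
      (auto simp: is_cobordism_def signed_set_def)
  then show ?thesis
    using assms by (auto simp: is_cobordism_def add_cob_def add_signed_def signed_set_def)
qed

text \<open>Negatives and creations keep the matching of a cobordism but list the summands on both
  of its sides in the opposite order.\<close>

lemma matching_swap_conj:
  assumes "matching F (P <+> Q) (R <+> S)"
  shows "matching (sum_swap \<circ> F \<circ> sum_swap) (Q <+> P) (S <+> R)"
  using assms
  by (intro matching_comp[OF matching_sum_swap] matching_comp[OF _ matching_sum_swap])
    (auto simp: matching_def dest: finite_PlusD)

lemma is_cobordism_neg:
  assumes "f : A \<Rrightarrow> B"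
  shows "neg_cob f : neg_signed B \<Rrightarrow> neg_signed A"
  using assms
  by (auto simp: is_cobordism_def neg_cob_def neg_signed_def signed_set_def
      intro!: matching_swap_conj)

lemma is_cobordism_diff:
  assumes "f : A \<Rrightarrow> B" and "g : C \<Rrightarrow> D"
  shows "diff_cob f g : A \<ominus> D \<Rrightarrow> B \<ominus> C"
  unfolding diff_cob_def diff_signed_def
  using assms by (intro is_cobordism_add is_cobordism_neg)

lemma is_cobordism_create:
  assumes "\<phi> : A \<Rrightarrow> B"
  shows "create \<phi> : zero_signed \<Rrightarrow> B \<ominus> A"
proof -
  \<comment> \<open>The source \<open>zero_signed\<close> contributes an empty left summand to both
    sides of the creation.\<close>
  have "matching id {} {}"
    by (simp add: matching_def bij_betw_def)
  then show ?thesis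
    using assms
    by (auto simp: is_cobordism_def create_def zero_signed_def diff_signed_def add_signed_def
        neg_signed_def signed_set_def intro!: matching_map_sum matching_swap_conj)
qed

section \<open>Transport along identifications\<close>

text \<open>The positive and negative parts of one signed set lie on opposite sides of the matching.
  Injectivity on each part therefore makes \<open>map_sum i j\<close> a matching on the domain and
  on the codomain.\<close>

lemma is_cobordism_relabel:
  assumes f: "f : A \<Rrightarrow> B"
    and i: "inj_on i (pos A)" "inj_on i (neg A)"
    and j: "inj_on j (pos B)" "inj_on j (neg B)"
  shows "relabel i j f : image_signed i A \<Rrightarrow> image_signed j B"
proof -
  have fin: "finite (pos A)" "finite (neg A)" "finite (pos B)" "finite (neg B)"
    using f by (auto simp: is_cobordism_def signed_set_def)
  have dom: "matching (map_sum i j) (pos A <+> neg B) (i ` pos A <+> j ` neg B)"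
    and cod: "matching (map_sum i j) (neg A <+> pos B) (i ` neg A <+> j ` pos B)"
    by (intro matching_map_sum; use i j fin in \<open>simp add: matching_def bij_betw_def\<close>)+
  have "matching (inv_into (pos A <+> neg B) (map_sum i j))
      (i ` pos A <+> j ` neg B) (pos A <+> neg B)"
    using dom by (auto simp: matching_def intro: bij_betw_inv_into)
  then have "matching (map_sum i j \<circ> mat f \<circ> inv_into (pos A <+> neg B) (map_sum i j))
      (i ` pos A <+> j ` neg B) (i ` neg A <+> j ` pos B)"
    using f by (intro matching_comp[OF _ matching_comp[OF _ cod]]) (auto simp: is_cobordism_def)
  then show ?thesis
    using f by (auto simp: is_cobordism_def relabel_def image_signed_def signed_set_def)
qed

lemma is_cobordism_relabel':
  assumes "f : A \<Rrightarrow> B"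
    and "inj_on i (pos A)" "inj_on i (neg A)" "image_signed i A = A'"
    and "inj_on j (pos B)" "inj_on j (neg B)" "image_signed j B = B'"
  shows "relabel i j f : A' \<Rrightarrow> B'"
  using is_cobordism_relabel[of f A B i j] assms by simp

text \<open>Both parts of \<open>zero_signed\<close> are empty, so \<open>projl\<close> meets only
  \<open>Inl\<close> elements.\<close>

lemma ident_zero_identifies:
  shows "inj_on ident_zero (pos (A \<oplus> zero_signed))"
    and "inj_on ident_zero (neg (A \<oplus> zero_signed))"
    and "image_signed ident_zero (A \<oplus> zero_signed) = A"
  by (auto simp: ident_zero_def add_signed_def zero_signed_def image_signed_def inj_on_def
      Plus_def image_image)

text \<open>Merging the two copies is injective because \<open>P\<close> and \<open>Q - P\<close>
  are disjoint. This is applied to each sign separately, since an element may lie in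
  \<open>pos A\<close> and in \<open>neg X - neg A\<close> at once.\<close>

lemma bij_betw_ident_compl:
  assumes "P \<subseteq> Q"
  shows "bij_betw ident_compl (P <+> ((Q - P) <+> R)) (Q <+> R)"
  unfolding bij_betw_def
proof
  show "inj_on ident_compl (P <+> ((Q - P) <+> R))"
    by (auto simp: ident_compl_def inj_on_def)
  show "ident_compl ` (P <+> ((Q - P) <+> R)) = Q <+> R"
    using assms by (simp add: ident_compl_def Plus_def image_Un image_image flip: Un_assoc)
      (simp add: Un_absorb1 flip: image_Un)
qed

lemma ident_compl_identifies:
  assumes "A \<sqsubseteq> X"
  shows "inj_on ident_compl (pos (A \<oplus> (X \<setminus> A \<ominus> Y)))"
    and "inj_on ident_compl (neg (A \<oplus> (X \<setminus> A \<ominus> Y)))"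
    and "image_signed ident_compl (A \<oplus> (X \<setminus> A \<ominus> Y)) = X \<ominus> Y"
  \<comment> \<open>Subtracting \<open>Y\<close> puts its negative part on the positive side, and
    conversely.\<close>
  using assms bij_betw_ident_compl[of "pos A" "pos X" "neg Y"]
    bij_betw_ident_compl[of "neg A" "neg X" "pos Y"]
  by (simp_all add: sub_signed_def diff_signed_def add_signed_def neg_signed_def
      setminus_signed_def image_signed_def bij_betw_def)

text \<open>Here the complement stands after \<open>Y\<close>; exchanging the two reduces this to
  \<open>ident_compl\<close>.\<close>

lemma ident_neg_compl_identifies:
  assumes "B \<sqsubseteq> X"
  shows "inj_on ident_neg_compl (pos (B \<ominus> (Y \<ominus> (X \<setminus> B))))"
    and "inj_on ident_neg_compl (neg (B \<ominus> (Y \<ominus> (X \<setminus> B))))"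
    and "image_signed ident_neg_compl (B \<ominus> (Y \<ominus> (X \<setminus> B))) = X \<ominus> Y"
proof -
  have "bij_betw ident_neg_compl (P <+> (R <+> (Q - P))) (Q <+> R)" if "P \<subseteq> Q"
    for P Q :: "'a set" and R :: "'b set"
  proof -
    have "bij_betw (map_sum id sum_swap) (P <+> (R <+> (Q - P))) (P <+> ((Q - P) <+> R))"
      by (auto intro!: bij_betw_byWitness[where f' = "map_sum id sum_swap"])
    then show ?thesis
      unfolding ident_neg_compl_def
      using bij_betw_ident_compl[OF that] by (rule bij_betw_trans)
  qed
  then show "inj_on ident_neg_compl (pos (B \<ominus> (Y \<ominus> (X \<setminus> B))))"
    and "inj_on ident_neg_compl (neg (B \<ominus> (Y \<ominus> (X \<setminus> B))))"
    and "image_signed ident_neg_compl (B \<ominus> (Y \<ominus> (X \<setminus> B))) = X \<ominus> Y"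
    using assms
    by (auto simp: sub_signed_def diff_signed_def add_signed_def neg_signed_def
        setminus_signed_def image_signed_def bij_betw_def)
qed

theorem corollary6:
  fixes X A B :: "'x signed" and Y :: "'y signed"
    and \<phi> :: "('y, 'x) cobordism" and \<psi> :: "('x, 'y) cobordism"
  assumes "signed_set X" and "signed_set Y"
    and "A \<sqsubseteq> X" and "B \<sqsubseteq> X"
    and "\<phi> : Y \<Rrightarrow> X \<setminus> A"
    and "\<psi> : X \<setminus> B \<Rrightarrow> Y"
  shows "let f = relabel ident_zero ident_compl (add_cob (id_cob A) (create \<phi>));
             g = relabel ident_neg_compl ident_zero (diff_cob (id_cob B) (create \<psi>))
         in f : A \<Rrightarrow> X \<ominus> Y \<and> g : X \<ominus> Y \<Rrightarrow> B \<and> comp_defined f g \<and> f \<triangleleft> g : A \<Rrightarrow> B"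
proof -
  have "signed_set A" "signed_set B"
    using assms(1,3,4) by (auto simp: signed_set_def sub_signed_def intro: finite_subset)
  then have add: "add_cob (id_cob A) (create \<phi>) : A \<oplus> zero_signed \<Rrightarrow> A \<oplus> (X \<setminus> A \<ominus> Y)"
    and "diff_cob (id_cob B) (create \<psi>) : B \<ominus> (Y \<ominus> (X \<setminus> B)) \<Rrightarrow> B \<ominus> zero_signed"
    using assms(5,6)
    by (auto intro!: is_cobordism_add is_cobordism_diff is_cobordism_id is_cobordism_create)
  \<comment> \<open>The target of \<open>diff_cob\<close> subtracts the zero source of
    \<open>create \<psi>\<close>, whereas \<open>ident_zero\<close> expects a sum.\<close>
  moreover have "B \<ominus> zero_signed = B \<oplus> zero_signed"
    by (simp add: diff_signed_def neg_signed_def zero_signed_def)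
  ultimately have diff:
    "diff_cob (id_cob B) (create \<psi>) : B \<ominus> (Y \<ominus> (X \<setminus> B)) \<Rrightarrow> B \<oplus> zero_signed"
    by simp
  \<comment> \<open>The target of the first factor and the source of the second are both identified
    with \<open>X \<ominus> Y\<close>, which makes the factors composable.\<close>
  have f: "relabel ident_zero ident_compl (add_cob (id_cob A) (create \<phi>)) : A \<Rrightarrow> X \<ominus> Y"
    by (rule is_cobordism_relabel'[OF add ident_zero_identifies
          ident_compl_identifies[OF assms(3)]])
  have g: "relabel ident_neg_compl ident_zero (diff_cob (id_cob B) (create \<psi>)) : X \<ominus> Y \<Rrightarrow> B"
    by (rule is_cobordism_relabel'[OF diff ident_neg_compl_identifies[OF assms(4)]
          ident_zero_identifies])
  show ?thesis
    using f g is_cobordism_comp[OF f g] by (simp add: Let_def)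
qed

end
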